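(* Let $\delta=1$ (resp. $\delta=-1$), let $k_0,k_1,k_2\in\mathbb{R}\setminus\{0\}$, and let $\psi(v_x)$ be any strictly monotone smooth function (with $\psi'\ne0$ where the system is considered). Then the system $$u_{xt}=k_1e^{k_0u}\psi(v_x),\qquad v_{xt}=k_1(\delta k_2^{-2}-k_0^2)e^{k_0u}\frac{u_x}{\psi'(v_x)}$$ describes pseudospherical surfaces (resp. spherical surfaces), with associated functions $$f_{11}=k_2^{-1}u_x,\quad f_{21}=\eta,\quad f_{31}=\eta k_0k_2+\psi(v_x),\quad f_{12}=0,\quad f_{22}=-k_1k_2^{-1}e^{k_0u},\quad f_{32}=-k_0k_1e^{k_0u},$$ where $\eta\in\mathbb{R}$.
   Context: Definition. A system of PDEs for $u(x,t),v(x,t)$ describes pseudospherical surfaces (take $\delta=1$), resp. spherical surfaces (take $\delta=-1$), with associated functions $f_{ij}$, $1\le i\le 3$, $1\le j\le 2$, if the system is equivalent to (i.e. has exactly the same solutions $(u,v)$ as) the structure equations $d\omega_1=\omega_3\wedge\omega_2$, $d\omega_2=\omega_1\wedge\omega_3$, $d\omega_3=\delta\,\omega_1\wedge\omega_2$ of a surface with Gaussian curvature $K=-\delta$, where $\omega_i=f_{i1}dx+f_{i2}dt$ and $f_{ij}$ are evaluated on $u,v$ and their derivatives, with $\omega_1\wedge\omega_2\neq0$, i.e. $f_{11}f_{22}-f_{12}f_{21}\ne 0$, for generic solutions (on a suitable nonempty open set); i.e. $f_{11}f_{22}-f_{12}f_{21}$, as a function of $(u,u_x,v,v_x)$, is nonzero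 up to a set of measure zero. *)

theory Defs
  imports "HOL-Analysis.Analysis"
begin

definition dir_deriv :: "'a::real_normed_vector \<Rightarrow> ('a \<Rightarrow> real) \<Rightarrow> 'a \<Rightarrow> real" where
  "dir_deriv b f p = deriv (\<lambda>s. f (p + s *\<^sub>R b)) 0"

text \<open>Smoothness means \<open>C\<^sup>\<infinity>\<close>: all iterated partial derivatives exist and are (Frechet)
  differentiable. It is only meant for open sets \<open>S\<close>.\<close>

definition smooth_on :: "'a::euclidean_space set \<Rightarrow> ('a \<Rightarrow> real) \<Rightarrow> bool" where
  "smooth_on S f \<longleftrightarrow>
     (\<forall>bs. set bs \<subseteq> Basis \<longrightarrow> foldr dir_deriv bs f differentiable_on S)"

text \<open>Points of the plane are \<open>(x, t)\<close>. With the two operators below, \<open>D\<^sub>t (D\<^sub>x u)\<close> is \<open>u\<^sub>x\<^sub>t\<close>.\<close>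

definition D_x :: "(real \<times> real \<Rightarrow> real) \<Rightarrow> real \<times> real \<Rightarrow> real" (\<open>D\<^sub>x\<close>) where
  "D\<^sub>x = dir_deriv (1, 0)"

definition D_t :: "(real \<times> real \<Rightarrow> real) \<Rightarrow> real \<times> real \<Rightarrow> real" (\<open>D\<^sub>t\<close>) where
  "D\<^sub>t = dir_deriv (0, 1)"

text \<open>A one-form \<open>a dx + b dt\<close> is the pair \<open>(a, b)\<close>; a two-form is represented by its coefficient
  with respect to \<open>dx \<and> dt\<close>.\<close>

type_synonym one_form = "(real \<times> real \<Rightarrow> real) \<times> (real \<times> real \<Rightarrow> real)"

definition ext_d :: "one_form \<Rightarrow> real \<times> real \<Rightarrow> real" where
  "ext_d \<alpha> p = D\<^sub>x (snd \<alpha>) p - D\<^sub>t (fst \<alpha>) p"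

definition wedge :: "one_form \<Rightarrow> one_form \<Rightarrow> real \<times> real \<Rightarrow> real" where
  "wedge \<alpha> \<beta> p = fst \<alpha> p * snd \<beta> p - snd \<alpha> p * fst \<beta> p"

text \<open>Jets are \<open>(u, u\<^sub>x, v, v\<^sub>x)\<close>.\<close>

type_synonym jet = "real \<times> real \<times> real \<times> real"

definition jet_at :: "(real \<times> real \<Rightarrow> real) \<Rightarrow> (real \<times> real \<Rightarrow> real) \<Rightarrow> real \<times> real \<Rightarrow> jet" where
  "jet_at u v p = (u p, D\<^sub>x u p, v p, D\<^sub>x v p)"

text \<open>The associated functions \<open>f\<^sub>i\<^sub>j\<close> are given as \<open>f i j\<close>; only \<open>i \<in> {1,2,3}\<close> and \<open>j \<in> {1,2}\<close> matter.\<close>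

definition assoc_form ::
  "(nat \<Rightarrow> nat \<Rightarrow> jet \<Rightarrow> real) \<Rightarrow> (real \<times> real \<Rightarrow> real) \<Rightarrow> (real \<times> real \<Rightarrow> real) \<Rightarrow> nat \<Rightarrow> one_form" where
  "assoc_form f u v i = (\<lambda>p. f i 1 (jet_at u v p), \<lambda>p. f i 2 (jet_at u v p))"

definition structure_eqs ::
  "real \<Rightarrow> (nat \<Rightarrow> nat \<Rightarrow> jet \<Rightarrow> real) \<Rightarrow>
   (real \<times> real \<Rightarrow> real) \<Rightarrow> (real \<times> real \<Rightarrow> real) \<Rightarrow> real \<times> real \<Rightarrow> bool" where
  "structure_eqs \<delta> f u v p \<longleftrightarrow>
     (let \<omega> = assoc_form f u v in
        ext_d (\<omega> 1) p = wedge (\<omega> 3) (\<omega> 2) p \<and>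
        ext_d (\<omega> 2) p = wedge (\<omega> 1) (\<omega> 3) p \<and>
        ext_d (\<omega> 3) p = \<delta> * wedge (\<omega> 1) (\<omega> 2) p)"

text \<open>A system of differential equations is a predicate \<open>E u v p\<close>, ``\<open>(u, v)\<close> satisfies the equations
  at the point \<open>p\<close>''. The set \<open>J\<close> of jets is the region where the system is considered.\<close>

type_synonym pde_system =
  "(real \<times> real \<Rightarrow> real) \<Rightarrow> (real \<times> real \<Rightarrow> real) \<Rightarrow> real \<times> real \<Rightarrow> bool"

definition is_solution ::
  "jet set \<Rightarrow> pde_system \<Rightarrow> (real \<times> real) set \<Rightarrow>
   (real \<times> real \<Rightarrow> real) \<Rightarrow> (real \<times> real \<Rightarrow> real) \<Rightarrow> bool" where
  "is_solution J E U u v \<longleftrightarrow>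
     smooth_on U u \<and> smooth_on U v \<and> (\<forall>p\<in>U. jet_at u v p \<in> J \<and> E u v p)"

text \<open>The Gaussian curvature of the surfaces is \<open>K = -\<delta>\<close>. The last clause is the generic
  nonvanishing of \<open>\<omega>\<^sub>1 \<and> \<omega>\<^sub>2\<close>.\<close>

definition describes_surfaces ::
  "real \<Rightarrow> jet set \<Rightarrow> pde_system \<Rightarrow> (nat \<Rightarrow> nat \<Rightarrow> jet \<Rightarrow> real) \<Rightarrow> bool" where
  "describes_surfaces \<delta> J E f \<longleftrightarrow>
     open J \<and> J \<noteq> {} \<and>
     (\<forall>i\<in>{1,2,3}. \<forall>j\<in>{1,2}. smooth_on J (f i j)) \<and>
     (\<forall>U u v. open U \<longrightarrow> is_solution J E U u v = is_solution J (structure_eqs \<delta> f) U u v) \<and>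
     negligible {z \<in> J. f 1 1 z * f 2 2 z - f 1 2 z * f 2 1 z = 0}"

definition describes_pseudospherical ::
  "jet set \<Rightarrow> pde_system \<Rightarrow> (nat \<Rightarrow> nat \<Rightarrow> jet \<Rightarrow> real) \<Rightarrow> bool" where
  "describes_pseudospherical = describes_surfaces 1"

definition describes_spherical ::
  "jet set \<Rightarrow> pde_system \<Rightarrow> (nat \<Rightarrow> nat \<Rightarrow> jet \<Rightarrow> real) \<Rightarrow> bool" where
  "describes_spherical = describes_surfaces (-1)"

end

theory Submission
  imports Defs
begin

text \<open>Every associated function depends on a single jet coordinate, so on smooth \<open>u, v\<close> the
  exterior derivatives can be computed with the chain rule (\<open>dir_deriv_compose\<close>).
  Writing \<open>e = exp (k\<^sub>0 u)\<close>, the structure equations become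

  \<^item> \<open>- u\<^sub>x\<^sub>t / k\<^sub>2 = - (k\<^sub>1 / k\<^sub>2) e \<psi>\<close>, where the two terms with \<open>\<eta>\<close> have cancelled;
  \<^item> \<open>- (k\<^sub>0 k\<^sub>1 / k\<^sub>2) e u\<^sub>x = - (k\<^sub>0 k\<^sub>1 / k\<^sub>2) e u\<^sub>x\<close>, an identity;
  \<^item> \<open>- k\<^sub>0\<^sup>2 k\<^sub>1 e u\<^sub>x - \<psi>' v\<^sub>x\<^sub>t = - \<delta> (k\<^sub>1 / k\<^sub>2\<^sup>2) e u\<^sub>x\<close>.

  The first equation is the equation for \<open>u\<^sub>x\<^sub>t\<close>, and wherever \<open>\<psi>' \<noteq> 0\<close> the third one can be
  solved for \<open>v\<^sub>x\<^sub>t\<close> and gives the second equation of the system. Hence the two systems agree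
  pointwise (\<open>structure_eqs_iff_system\<close>), for either sign of \<open>\<delta>\<close>.

  The remaining conditions are regularity ones. The jet region is open because \<open>\<psi>'\<close> is
  continuous, and nonempty because a strictly monotone \<open>\<psi>\<close> cannot have zero derivative on a whole
  interval (\<open>strict_monotone_imp_deriv_nonzero\<close>). The associated functions are
  smooth because a smooth function of one real variable stays smooth when composed with a linear
  coordinate (\<open>smooth_on_compose_linear\<close>). Finally
  \<open>\<omega>\<^sub>1 \<and> \<omega>\<^sub>2\<close> has the coefficient \<open>- (k\<^sub>1 / k\<^sub>2\<^sup>2) u\<^sub>x e\<close>, which vanishes only on the
  hyperplane \<open>u\<^sub>x = 0\<close>.\<close>

section \<open>Directional derivatives and the chain rule\<close>

lemma dir_deriv_compose:
  fixes h :: "'a::real_normed_vector \<Rightarrow> real"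
  assumes h: "h differentiable at p" and g: "g differentiable at (h p)"
  shows "dir_deriv b (\<lambda>q. g (h q)) p = deriv g (h p) * dir_deriv b h p"
proof -
  have "(\<lambda>s. p + s *\<^sub>R b) differentiable at (0::real)"
    by (auto intro!: derivative_intros)
  moreover have "h differentiable at (p + 0 *\<^sub>R b)"
    using h by simp
  ultimately have "(\<lambda>s. h (p + s *\<^sub>R b)) differentiable at 0"
    using differentiable_chain_at[of "\<lambda>s. p + s *\<^sub>R b" 0 h] by (simp add: o_def)
  then have "(\<lambda>s. h (p + s *\<^sub>R b)) field_differentiable at 0"
    by (simp add: real_differentiable_def field_differentiable_def)
  moreover have "g field_differentiable at (h (p + 0 *\<^sub>R b))"
    using g by (simp add: real_differentiable_def field_differentiable_def)
  ultimately show ?thesis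
    using deriv_chain[of "\<lambda>s. h (p + s *\<^sub>R b)" 0 g] by (simp add: dir_deriv_def o_def)
qed

lemma dir_deriv_const [simp]: "dir_deriv b (\<lambda>q. c) p = 0"
  by (simp add: dir_deriv_def)

lemma dir_deriv_linear:
  assumes "bounded_linear L"
  shows "dir_deriv b L p = L b"
proof -
  interpret bounded_linear L by fact
  have "((\<lambda>s. L p + s * L b) has_real_derivative L b) (at 0)"
    by (auto intro!: derivative_eq_intros)
  then show ?thesis
    by (simp add: dir_deriv_def add scaleR DERIV_imp_deriv)
qed

text \<open>The derivative only depends on the germ. This is needed because a function that is smooth
  on \<open>S\<close> may be arbitrary outside \<open>S\<close>.\<close>

lemma dir_deriv_cong_open:
  fixes f g :: "'a::real_normed_vector \<Rightarrow> real"
  assumes "open S" "p \<in> S" and eq: "\<And>q. q \<in> S \<Longrightarrow> f q = g q"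
  shows "dir_deriv b f p = dir_deriv b g p"
proof -
  have "((\<lambda>s::real. p + s *\<^sub>R b) \<longlongrightarrow> p + 0 *\<^sub>R b) (nhds 0)"
    by (intro tendsto_intros filterlim_ident)
  then have "eventually (\<lambda>s::real. p + s *\<^sub>R b \<in> S) (nhds 0)"
    using assms(1,2) by (intro topological_tendstoD) auto
  then have "eventually (\<lambda>s::real. f (p + s *\<^sub>R b) = g (p + s *\<^sub>R b)) (nhds 0)"
    by eventually_elim (rule eq)
  then show ?thesis
    unfolding dir_deriv_def by (intro deriv_cong_ev) auto
qed

section \<open>Smooth functions of one real variable\<close>

lemma dir_deriv_1: "dir_deriv (1::real) = deriv"
  by (intro ext) (simp add: dir_deriv_def deriv_shift_0[unfolded o_def, symmetric])

lemma smooth_on_real_iff: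
  fixes g :: "real \<Rightarrow> real"
  shows "smooth_on T g \<longleftrightarrow> (\<forall>n. (deriv ^^ n) g differentiable_on T)"
proof
  assume L: "smooth_on T g"
  show "\<forall>n. (deriv ^^ n) g differentiable_on T"
  proof
    fix n
    have "foldr dir_deriv (replicate n (1::real)) g differentiable_on T"
      using L by (simp add: smooth_on_def set_replicate_conv_if del: foldr_replicate)
    then show "(deriv ^^ n) g differentiable_on T"
      by (simp add: foldr_replicate dir_deriv_1)
  qed
next
  assume R: "\<forall>n. (deriv ^^ n) g differentiable_on T"
  show "smooth_on T g"
    unfolding smooth_on_def
  proof (intro allI impI)
    fix bs :: "real list"
    assume "set bs \<subseteq> Basis"
    then have "bs = replicate (length bs) 1"
      by (intro replicate_length_same[symmetric]) auto
    then have "foldr dir_deriv bs g = foldr dir_deriv (replicate (length bs) 1) g"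
      by (rule arg_cong)
    then have "foldr dir_deriv bs g = (deriv ^^ length bs) g"
      by (simp only: foldr_replicate dir_deriv_1)
    then show "foldr dir_deriv bs g differentiable_on T"
      using R by simp
  qed
qed

lemma smooth_on_deriv_differentiable:
  assumes "smooth_on T g" "open T" "x \<in> T"
  shows "g differentiable at x" "deriv g differentiable at x"
proof -
  have "(deriv ^^ n) g differentiable at x" for n
    using assms by (auto simp: smooth_on_real_iff differentiable_on_eq_differentiable_at)
  from this[of 0] this[of 1] show "g differentiable at x" "deriv g differentiable at x"
    by simp_all
qed

text \<open>If \<open>g' = a g + b\<close>, then every iterated derivative of \<open>g\<close> has the form \<open>c g + d\<close>. This covers
  affine and exponential functions, which give all associated functions other than \<open>f\<^sub>3\<^sub>1\<close>.\<close>

lemma smooth_on_autonomous: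
  fixes g :: "real \<Rightarrow> real"
  assumes "\<And>x. (g has_real_derivative a * g x + b) (at x)"
  shows "smooth_on T g"
proof -
  have "\<exists>c d. (deriv ^^ n) g = (\<lambda>x. c * g x + d)" for n
  proof (induction n)
    case 0
    show ?case by (rule exI[of _ 1], rule exI[of _ 0]) simp
  next
    case (Suc n)
    then obtain c d where cd: "(deriv ^^ n) g = (\<lambda>x. c * g x + d)" by blast
    have "((\<lambda>x. c * g x + d) has_real_derivative c * a * g x + c * b) (at x)" for x
      by (rule derivative_eq_intros assms refl | simp add: algebra_simps)+
    then have "deriv (\<lambda>x. c * g x + d) = (\<lambda>x. c * a * g x + c * b)"
      by (intro ext DERIV_imp_deriv)
    then show ?case using cd by auto
  qed
  moreover have "g differentiable at x within T" for x
    using assms has_field_derivative_at_within real_differentiable_def by blast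
  then have "(\<lambda>x. c * g x + d) differentiable_on T" for c d
    unfolding differentiable_on_def
    by (intro ballI differentiable_add differentiable_mult differentiable_const)
  ultimately show ?thesis
    unfolding smooth_on_real_iff by metis
qed

lemma smooth_on_add_const:
  fixes g :: "real \<Rightarrow> real"
  assumes "smooth_on T g"
  shows "smooth_on T (\<lambda>x. c + g x)"
proof -
  have "((\<lambda>x. c + g x) has_real_derivative D) (at x) \<longleftrightarrow> (g has_real_derivative D) (at x)" for D x
    using DERIV_add[OF DERIV_const[of c], of g D x UNIV]
      DERIV_add[OF DERIV_const[of "- c"], of "\<lambda>x. c + g x" D x UNIV] by auto
  \<comment> \<open>\<open>deriv\<close> is a choice of such a \<open>D\<close>, so the two derivatives are equal even where \<open>g\<close> has none.\<close>
  then have "deriv (\<lambda>x. c + g x) = deriv g"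
    by (simp add: deriv_def fun_eq_iff)
  then have higher: "(deriv ^^ Suc n) (\<lambda>x. c + g x) = (deriv ^^ Suc n) g" for n
    by (simp add: funpow_Suc_right del: funpow.simps)
  have diff: "(\<lambda>x. c + g x) differentiable_on T"
    using assms by (auto simp: smooth_on_real_iff differentiable_on_def dest: spec[of _ 0])
  show ?thesis
    unfolding smooth_on_real_iff
  proof (intro allI)
    fix n
    show "(deriv ^^ n) (\<lambda>x. c + g x) differentiable_on T"
    proof (cases n)
      case 0
      then show ?thesis using diff by simp
    next
      case (Suc m)
      then show ?thesis using higher[of m] assms by (simp only: smooth_on_real_iff)
    qed
  qed
qed

section \<open>Smoothness of functions of one linear coordinate\<close>

text \<open>Each derivative in a direction \<open>b\<close> produces the constant factor \<open>L b\<close> and replaces \<open>g\<close> by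
  its derivative, so all iterated derivatives are again functions of \<open>L\<close> alone.\<close>

lemma foldr_dir_deriv_compose_linear:
  assumes "smooth_on T g" "open T" "bounded_linear L" "open S" "L ` S \<subseteq> T" "p \<in> S"
  shows "foldr dir_deriv bs (\<lambda>z. g (L z)) p
           = prod_list (map L bs) * (deriv ^^ length bs) g (L p)"
  using \<open>p \<in> S\<close>
proof (induction bs arbitrary: p)
  case Nil
  show ?case by simp
next
  case (Cons b bs)
  let ?c = "prod_list (map L bs)" and ?G = "(deriv ^^ length bs) g"
  have G: "?G differentiable at (L p)"
    using assms Cons.prems by (auto simp: smooth_on_real_iff differentiable_on_eq_differentiable_at)
  have "foldr dir_deriv (b # bs) (\<lambda>z. g (L z)) p = dir_deriv b (\<lambda>z. ?c * ?G (L z)) p"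
    using dir_deriv_cong_open[OF \<open>open S\<close> Cons.prems Cons.IH] by simp
  also have "\<dots> = deriv (\<lambda>y. ?c * ?G y) (L p) * dir_deriv b L p"
    using bounded_linear_imp_differentiable[OF \<open>bounded_linear L\<close>]
      differentiable_mult[OF differentiable_const G] by (rule dir_deriv_compose)
  also have "deriv (\<lambda>y. ?c * ?G y) (L p) = ?c * deriv ?G (L p)"
    using G by (intro deriv_cmult) (simp add: real_differentiable_def field_differentiable_def)
  finally show ?case
    by (simp add: dir_deriv_linear[OF \<open>bounded_linear L\<close>] algebra_simps)
qed

lemma smooth_on_compose_linear:
  fixes L :: "'a::euclidean_space \<Rightarrow> real"
  assumes "smooth_on T g" "open T" "bounded_linear L" "open S" "L ` S \<subseteq> T"
  shows "smooth_on S (\<lambda>z. g (L z))"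
  unfolding smooth_on_def differentiable_on_eq_differentiable_at[OF \<open>open S\<close>]
proof (intro allI impI ballI)
  fix bs p assume p: "p \<in> S"
  let ?h = "\<lambda>z. prod_list (map L bs) * (deriv ^^ length bs) g (L z)"
  have "(deriv ^^ length bs) g differentiable at (L p)"
    using assms p by (auto simp: smooth_on_real_iff differentiable_on_eq_differentiable_at)
  then have "(\<lambda>z. (deriv ^^ length bs) g (L z)) differentiable at p"
    using differentiable_chain_at[OF bounded_linear_imp_differentiable[OF \<open>bounded_linear L\<close>]]
    by (simp add: o_def)
  then have "?h differentiable at p"
    by (intro derivative_intros)
  then obtain D where "(?h has_derivative D) (at p)"
    unfolding differentiable_def by blast
  then have "(foldr dir_deriv bs (\<lambda>z. g (L z)) has_derivative D) (at p)"
    using \<open>open S\<close> p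
    by (rule has_derivative_transform_within_open)
      (simp add: foldr_dir_deriv_compose_linear[OF assms])
  then show "foldr dir_deriv bs (\<lambda>z. g (L z)) differentiable at p"
    unfolding differentiable_def by blast
qed

section \<open>The structure equations along smooth functions\<close>

lemma smooth_on_partial_differentiable:
  assumes "smooth_on U u" "open U" "p \<in> U"
  shows "u differentiable at p" "D\<^sub>x u differentiable at p"
proof -
  have "foldr dir_deriv bs u differentiable at p" if "set bs \<subseteq> Basis" for bs
    using assms that by (auto simp: smooth_on_def differentiable_on_eq_differentiable_at)
  from this[of "[]"] this[of "[(1, 0)]"]
  show "u differentiable at p" "D\<^sub>x u differentiable at p"
    by (simp_all add: D_x_def Basis_prod_def)
qed

text \<open>These are the three structure equations with the exterior derivatives expanded, where \<open>e\<close>,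
  \<open>r\<close> and \<open>q\<close> stand for \<open>exp (k\<^sub>0 u)\<close>, \<open>\<psi> v\<^sub>x\<close> and \<open>\<psi>' v\<^sub>x\<close>. The coefficient \<open>\<eta> k\<^sub>0 k\<^sub>2\<close> in \<open>f\<^sub>3\<^sub>1\<close>
  is what makes \<open>\<eta>\<close> cancel in the first one.\<close>

lemma structure_eqs_algebra:
  fixes k0 k1 k2 q :: real
  assumes "k2 \<noteq> 0" "q \<noteq> 0"
  shows "- (uxt / k2) = (\<eta> * k0 * k2 + r) * (- (k1 / k2) * e) - (- k0 * k1 * e) * \<eta>
           \<longleftrightarrow> uxt = k1 * e * r"
    and "- (k1 / k2) * (k0 * e * ux) = ux / k2 * (- k0 * k1 * e)"
    and "- k0 * k1 * (k0 * e * ux) - q * vxt = \<delta> * (ux / k2 * (- (k1 / k2) * e))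
           \<longleftrightarrow> vxt = k1 * (\<delta> / k2\<^sup>2 - k0\<^sup>2) * e * (ux / q)"
  using assms by (auto simp: field_simps power2_eq_square)

lemma structure_eqs_iff_system:
  fixes k0 k1 k2 :: real
  assumes "k2 \<noteq> 0"
    and u: "u differentiable at p" "D\<^sub>x u differentiable at p"
    and v: "D\<^sub>x v differentiable at p"
    and psi: "\<psi> differentiable at (D\<^sub>x v p)" "deriv \<psi> (D\<^sub>x v p) \<noteq> 0"
    and f: "f 1 1 = (\<lambda>z. fst (snd z) / k2)" "f 2 1 = (\<lambda>z. \<eta>)"
      "f 3 1 = (\<lambda>z. \<eta> * k0 * k2 + \<psi> (snd (snd (snd z))))"
      "f 1 2 = (\<lambda>z. 0)" "f 2 2 = (\<lambda>z. - (k1 / k2) * exp (k0 * fst z))"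
      "f 3 2 = (\<lambda>z. - k0 * k1 * exp (k0 * fst z))"
  shows "structure_eqs \<delta> f u v p \<longleftrightarrow>
          D\<^sub>t (D\<^sub>x u) p = k1 * exp (k0 * u p) * \<psi> (D\<^sub>x v p) \<and>
          D\<^sub>t (D\<^sub>x v) p = k1 * (\<delta> / k2\<^sup>2 - k0\<^sup>2) * exp (k0 * u p) * (D\<^sub>x u p / deriv \<psi> (D\<^sub>x v p))"
proof -
  have ddiv: "((\<lambda>y. y / k2) has_real_derivative 1 / k2) (at x)" for x
    using \<open>k2 \<noteq> 0\<close> by (auto intro!: derivative_eq_intros)
  have dexp: "((\<lambda>y. c * exp (k0 * y)) has_real_derivative c * (k0 * exp (k0 * x))) (at x)" for c x
    by (auto intro!: derivative_eq_intros)
  have dpsi: "((\<lambda>y. c + \<psi> y) has_real_derivative deriv \<psi> (D\<^sub>x v p)) (at (D\<^sub>x v p))" for c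
    using psi(1) by (auto intro!: derivative_eq_intros
        simp: real_differentiable_def dest: DERIV_imp_deriv)
  have chain: "dir_deriv b (\<lambda>q. g (h q)) p = g' * dir_deriv b h p"
    if "h differentiable at p" "(g has_real_derivative g') (at (h p))"
    for b g g' and h :: "real \<times> real \<Rightarrow> real"
    using dir_deriv_compose[OF that(1), of g b] that(2)
    by (auto simp: real_differentiable_def DERIV_imp_deriv)
  have Dt_ux: "D\<^sub>t (\<lambda>q. D\<^sub>x u q / k2) p = D\<^sub>t (D\<^sub>x u) p / k2"
    unfolding D_t_def using chain[OF u(2) ddiv] by simp
  have Dx_exp: "D\<^sub>x (\<lambda>q. c * exp (k0 * u q)) p = c * (k0 * exp (k0 * u p) * D\<^sub>x u p)" for c
    unfolding D_x_def using chain[OF u(1) dexp] by simp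
  have Dt_psi: "D\<^sub>t (\<lambda>q. c + \<psi> (D\<^sub>x v q)) p = deriv \<psi> (D\<^sub>x v p) * D\<^sub>t (D\<^sub>x v) p" for c
    unfolding D_t_def using chain[OF v dpsi] by simp
  have D_const: "D\<^sub>x (\<lambda>q. c) p = 0" "D\<^sub>t (\<lambda>q. c) p = 0" for c
    by (simp_all add: D_x_def D_t_def)
  note alg = structure_eqs_algebra[OF \<open>k2 \<noteq> 0\<close> psi(2)]
  show ?thesis
    unfolding structure_eqs_def Let_def ext_d_def wedge_def assoc_form_def jet_at_def f
      fst_conv snd_conv Dt_ux Dx_exp Dt_psi D_const diff_0 diff_0_right mult_zero_left alg(1,3)
    using alg(2) by simp
qed

section \<open>The region of jets\<close>

text \<open>Otherwise \<open>\<psi>\<close> would be constant on the interval, which contains two distinct points because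
  it is nonempty and open.\<close>

lemma strict_monotone_imp_deriv_nonzero:
  fixes \<psi> :: "real \<Rightarrow> real"
  assumes "open I" "is_interval I" "I \<noteq> {}"
    and diff: "\<And>x. x \<in> I \<Longrightarrow> \<psi> differentiable at x"
    and mono: "strict_mono_on I \<psi> \<or> strict_antimono_on I \<psi>"
  shows "\<exists>x\<in>I. deriv \<psi> x \<noteq> 0"
proof (rule ccontr)
  assume "\<not> ?thesis"
  then have "(\<psi> has_real_derivative 0) (at x within I)" if "x \<in> I" for x
    using that diff[OF that]
    by (metis DERIV_imp_deriv has_field_derivative_at_within real_differentiable_def)
  then obtain c where c: "\<And>x. x \<in> I \<Longrightarrow> \<psi> x = c"
    using has_field_derivative_zero_constant is_interval_convex[OF assms(2)] by metis
  obtain x where x: "x \<in> I" using assms(3) by blast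
  then obtain e where "e > 0" "ball x e \<subseteq> I"
    using assms(1) open_contains_ball by blast
  then have y: "x + e / 2 \<in> I" "x < x + e / 2"
    by (auto simp: subset_iff dist_real_def)
  then have "\<psi> x \<noteq> \<psi> (x + e / 2)"
    using mono x by (fastforce simp: monotone_on_def)
  then show False using c x y by simp
qed

lemma open_deriv_nonzero:
  assumes "smooth_on I \<psi>" "open I"
  shows "open {x \<in> I. deriv \<psi> x \<noteq> 0}"
proof -
  have "continuous_on I (deriv \<psi>)"
    using smooth_on_deriv_differentiable(2)[OF assms]
    by (auto intro!: continuous_at_imp_continuous_on differentiable_imp_continuous_within)
  then have "open (deriv \<psi> -` (- {0}) \<inter> I)"
    using assms(2) continuous_on_open_vimage by blast
  also have "deriv \<psi> -` (- {0}) \<inter> I = {x \<in> I. deriv \<psi> x \<noteq> 0}" by auto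
  finally show ?thesis .
qed

lemma negligible_jet_ux_zero: "negligible {z :: jet. fst (snd z) = 0}"
proof -
  let ?b = "(0, 1, 0, 0) :: jet"
  have "?b \<in> Basis" by (simp add: Basis_prod_def zero_prod_def)
  then have "negligible {z. z \<bullet> ?b = 0}" by (rule negligible_standard_hyperplane)
  then show ?thesis by (simp add: inner_prod_def)
qed

theorem corollary5p4:
  fixes \<delta> k0 k1 k2 \<eta> :: real
    and I :: "real set"
    and \<psi> :: "real \<Rightarrow> real"
    and J :: "jet set"
    and E :: pde_system
    and f :: "nat \<Rightarrow> nat \<Rightarrow> jet \<Rightarrow> real"
  assumes "\<delta> = 1 \<or> \<delta> = -1"
    and "k0 \<noteq> 0" and "k1 \<noteq> 0" and "k2 \<noteq> 0"
    and "open I" and "is_interval I" and "I \<noteq> {}"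
    and "smooth_on I \<psi>"
    and "strict_mono_on I \<psi> \<or> strict_antimono_on I \<psi>"
    and J: "J = {(u, ux, v, vx). vx \<in> I \<and> deriv \<psi> vx \<noteq> 0}"
    and E: "\<And>u v p. E u v p \<longleftrightarrow>
          D\<^sub>t (D\<^sub>x u) p = k1 * exp (k0 * u p) * \<psi> (D\<^sub>x v p) \<and>
          D\<^sub>t (D\<^sub>x v) p = k1 * (\<delta> / k2\<^sup>2 - k0\<^sup>2) * exp (k0 * u p) * (D\<^sub>x u p / deriv \<psi> (D\<^sub>x v p))"
    and f11: "\<And>u ux v vx. f 1 1 (u, ux, v, vx) = ux / k2"
    and f21: "\<And>u ux v vx. f 2 1 (u, ux, v, vx) = \<eta>"
    and f31: "\<And>u ux v vx. f 3 1 (u, ux, v, vx) = \<eta> * k0 * k2 + \<psi> vx"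
    and f12: "\<And>u ux v vx. f 1 2 (u, ux, v, vx) = 0"
    and f22: "\<And>u ux v vx. f 2 2 (u, ux, v, vx) = - (k1 / k2) * exp (k0 * u)"
    and f32: "\<And>u ux v vx. f 3 2 (u, ux, v, vx) = - k0 * k1 * exp (k0 * u)"
  shows "(\<delta> = 1 \<longrightarrow> describes_pseudospherical J E f) \<and>
         (\<delta> = -1 \<longrightarrow> describes_spherical J E f)"
proof -
  let ?K = "{x \<in> I. deriv \<psi> x \<noteq> 0}"
  have K: "open ?K" by (rule open_deriv_nonzero) fact+
  have psi: "\<psi> differentiable at x" if "x \<in> I" for x
    using \<open>smooth_on I \<psi>\<close> \<open>open I\<close> that by (rule smooth_on_deriv_differentiable(1))
  have J': "J = (\<lambda>z. snd (snd (snd z))) -` ?K"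
    using J by auto
  have f': "f 1 1 = (\<lambda>z. fst (snd z) / k2)" "f 2 1 = (\<lambda>z. \<eta>)"
    "f 3 1 = (\<lambda>z. \<eta> * k0 * k2 + \<psi> (snd (snd (snd z))))"
    "f 1 2 = (\<lambda>z. 0)" "f 2 2 = (\<lambda>z. - (k1 / k2) * exp (k0 * fst z))"
    "f 3 2 = (\<lambda>z. - k0 * k1 * exp (k0 * fst z))"
    using f11 f21 f31 f12 f22 f32 by (simp_all add: fun_eq_iff split_paired_All del: One_nat_def)
  have openJ: "open J"
    unfolding J' by (intro open_vimage K continuous_intros)
  obtain x where "x \<in> ?K"
    using strict_monotone_imp_deriv_nonzero[OF assms(5-7) psi assms(9)] by blast
  then have neJ: "(0, 0, 0, x) \<in> J" unfolding J' by simp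

  have lin: "bounded_linear (\<lambda>z::jet. fst z)" "bounded_linear (\<lambda>z::jet. fst (snd z))"
    "bounded_linear (\<lambda>z::jet. snd (snd (snd z)))"
    by (intro bounded_linear_intros)+
  have const: "smooth_on UNIV (\<lambda>x::real. c)" for c
    by (rule smooth_on_autonomous[where a = 0 and b = 0]) simp
  have div: "smooth_on UNIV (\<lambda>x::real. x / k2)"
    by (rule smooth_on_autonomous[where a = 0 and b = "1 / k2"])
      (use \<open>k2 \<noteq> 0\<close> in \<open>auto intro!: derivative_eq_intros\<close>)
  have expo: "smooth_on UNIV (\<lambda>x::real. c * exp (k0 * x))" for c
    by (rule smooth_on_autonomous[where a = k0 and b = 0]) (auto intro!: derivative_eq_intros)
  have psi_smooth: "smooth_on I (\<lambda>x. \<eta> * k0 * k2 + \<psi> x)"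
    using \<open>smooth_on I \<psi>\<close> by (rule smooth_on_add_const)
  have smooth: "smooth_on J (f i j)" if "i \<in> {1,2,3}" "j \<in> {1,2}" for i j
  proof -
    have "smooth_on J (f 1 1)" "smooth_on J (f 2 1)" "smooth_on J (f 1 2)"
      "smooth_on J (f 2 2)" "smooth_on J (f 3 2)"
      unfolding f'
      using smooth_on_compose_linear[OF div open_UNIV lin(2) openJ]
        smooth_on_compose_linear[OF const open_UNIV lin(1) openJ]
        smooth_on_compose_linear[OF expo open_UNIV lin(1) openJ]
      by blast+
    moreover have "smooth_on J (f 3 1)"
      unfolding f'
      by (rule smooth_on_compose_linear[OF psi_smooth \<open>open I\<close> lin(3) openJ]) (auto simp: J')
    ultimately show ?thesis using that by blast
  qed

  have sys: "E u v p \<longleftrightarrow> structure_eqs \<delta> f u v p"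
    if "open U" "smooth_on U u" "smooth_on U v" "p \<in> U" "jet_at u v p \<in> J" for U u v p
  proof -
    have "D\<^sub>x v p \<in> I" "deriv \<psi> (D\<^sub>x v p) \<noteq> 0"
      using that(5) by (auto simp: J jet_at_def)
    then show ?thesis
      unfolding E using smooth_on_partial_differentiable that psi \<open>k2 \<noteq> 0\<close>
      by (intro structure_eqs_iff_system[OF _ _ _ _ _ _ f', symmetric]) blast+
  qed
  then have equiv: "is_solution J E U u v = is_solution J (structure_eqs \<delta> f) U u v"
    if "open U" for U u v
    using that unfolding is_solution_def by blast

  have "{z \<in> J. f 1 1 z * f 2 2 z - f 1 2 z * f 2 1 z = 0} \<subseteq> {z. fst (snd z) = 0}"
    unfolding f' using \<open>k1 \<noteq> 0\<close> \<open>k2 \<noteq> 0\<close> by auto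
  then have "negligible {z \<in> J. f 1 1 z * f 2 2 z - f 1 2 z * f 2 1 z = 0}"
    by (rule negligible_subset[OF negligible_jet_ux_zero])
  then have "describes_surfaces \<delta> J E f"
    unfolding describes_surfaces_def using openJ neJ smooth equiv by blast
  then show ?thesis
    by (auto simp: describes_pseudospherical_def describes_spherical_def)
qed

end
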